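(* Let $X$ be a closed linear subspace of $c_0$ of finite codimension, equipped with the norm inherited from $c_0$. Then $X$ has an Auerbach basis.
   Context: Scalars are real. $c_0$ is the Banach space of scalar sequences converging to $0$, with the supremum norm. For a separable Banach space $X$, an Auerbach basis of $X$ is a sequence of pairs $(x_n;x_n^* )_{n=1}^{\infty}$ with $x_n\in X$ and $x_n^*\in X^*$ (the continuous dual, with the dual norm) such that: (1) (biorthogonal) $x_k^*(x_j)=\delta_{k,j}$ for all $k,j$; (2) (total) if $x\in X$ and $x_n^*(x)=0$ for every $n$, then $x=0$; (3) (fundamental) the closed linear span of $\{x_n\}_n$ is $X$; (4) $\|x_n\|=\|x_n^*\|=1$ for every $n$. *)

theory Defs
  imports "HOL-Analysis.Analysis"
begin

(* c_0 as a subspace of the bounded sequences: the topology on nat is discrete, so every bounded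
   sequence is a bounded continuous function, and the norm of that type is the supremum norm. *)
definition c0 :: "(nat \<Rightarrow>\<^sub>C real) set" where
  "c0 = {x. apply_bcontfun x \<longlonglongrightarrow> 0}"

lemma norm_eq_SUP: "norm x = (SUP n. \<bar>apply_bcontfun x n\<bar>)" for x :: "nat \<Rightarrow>\<^sub>C real"
  by (simp add: norm_bcontfun_def dist_bcontfun.rep_eq zero_bcontfun.rep_eq)

lemma subspace_c0: "subspace c0"
  unfolding subspace_def c0_def
  by (auto simp: plus_bcontfun.rep_eq zero_bcontfun.rep_eq scaleR_bcontfun.rep_eq
      intro: tendsto_add_zero tendsto_mult_right_zero)

(* By this lemma, a subset of c0 is closed in c0 if and only if it is closed in the whole type. *)
lemma closed_c0: "closed c0"
  unfolding closed_sequential_limits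
proof safe
  fix y :: "nat \<Rightarrow> nat \<Rightarrow>\<^sub>C real" and l
  assume y: "\<forall>k. y k \<in> c0" and lim: "y \<longlonglongrightarrow> l"
  have "\<exists>N. \<forall>n\<ge>N. norm (apply_bcontfun l n - 0) < e" if "e > 0" for e
  proof -
    obtain k where k: "norm (y k - l) < e / 2"
      using LIMSEQ_D[OF lim, of "e / 2"] \<open>e > 0\<close> by (meson half_gt_zero order_refl)
    obtain N where N: "\<forall>n\<ge>N. norm (apply_bcontfun (y k) n) < e / 2"
      using LIMSEQ_D[of "apply_bcontfun (y k)" 0 "e / 2"] y \<open>e > 0\<close> by (auto simp: c0_def)
    have "norm (apply_bcontfun l n) < e" if "n \<ge> N" for n
      using N that k norm_bounded[of "y k - l" n]
      by (force simp: minus_bcontfun.rep_eq)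
    then show ?thesis by auto
  qed
  then show "l \<in> c0"
    unfolding c0_def using LIMSEQ_I by blast
qed

(* The quotient V / X is finite-dimensional: the classes of finitely many vectors span it. *)
definition finite_codim :: "'a::real_vector set \<Rightarrow> 'a set \<Rightarrow> bool" where
  "finite_codim X V \<longleftrightarrow>
     (\<exists>F. finite F \<and> F \<subseteq> V \<and> (\<forall>v\<in>V. \<exists>u\<in>span F. v - u \<in> X))"

(* A functional on the subspace X is represented by any function on the whole type that
   restricts to it; the values outside X are irrelevant. *)
definition dual_on :: "'a::real_normed_vector set \<Rightarrow> ('a \<Rightarrow> real) set" where
  "dual_on X = {f. (\<forall>x\<in>X. \<forall>y\<in>X. f (x + y) = f x + f y) \<and>
                   (\<forall>c. \<forall>x\<in>X. f (c *\<^sub>R x) = c * f x) \<and>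
                   continuous_on X f}"

definition dual_norm_on :: "'a::real_normed_vector set \<Rightarrow> ('a \<Rightarrow> real) \<Rightarrow> real" where
  "dual_norm_on X f = (SUP x\<in>{x\<in>X. norm x \<le> 1}. \<bar>f x\<bar>)"

(* Meant for closed subspaces X, so that the closure in the whole type of a subset of X
   is its closure in X.  Sequences are indexed from 0. *)
definition auerbach_basis ::
    "'a::real_normed_vector set \<Rightarrow> (nat \<Rightarrow> 'a) \<Rightarrow> (nat \<Rightarrow> 'a \<Rightarrow> real) \<Rightarrow> bool" where
  "auerbach_basis X x f \<longleftrightarrow>
     (\<forall>n. x n \<in> X) \<and> (\<forall>n. f n \<in> dual_on X) \<and>
     (\<forall>k j. f k (x j) = (if k = j then 1 else 0)) \<and>
     (\<forall>y\<in>X. (\<forall>n. f n y = 0) \<longrightarrow> y = 0) \<and>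
     closure (span (range x)) = X \<and>
     (\<forall>n. norm (x n) = 1 \<and> dual_norm_on X (f n) = 1)"

end

(* Let m be the codimension of X. The vectors of X are cut out by m functionals phi_i, and
   phi_i(e_n) tends to 0 as n grows, so among all m-tuples of indices there is one, J, that maximizes
   the absolute value of det (phi_i(e_j)) for j in J. By Cramer's rule and maximality, every e_n is,
   modulo X, a combination of the e_j (j in J) with coefficients of absolute value at most 1.
   Subtracting this combination from e_n, for n outside J, gives a vector of X of norm 1, and these
   vectors together with the coordinate functionals outside J are the required basis. *)
theory Submission
  imports Defs "Jordan_Normal_Form.Determinant"
begin

section \<open>Determinants of selected columns and Cramer's rule\<close>

text \<open>In the Leibniz expansion every term has exactly one factor from column \<open>l\<close>,
  at most \<open>\<epsilon>\<close> in absolute value, and \<open>m - 1\<close> other factors, each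
  at most \<open>C\<close>. So a determinant is small as soon as one selected index lies far
  out.\<close>

lemma det_selection_bound:
  fixes a :: "nat \<Rightarrow> nat \<Rightarrow> real"
  assumes C: "\<And>i n. i < m \<Longrightarrow> \<bar>a i n\<bar> \<le> C" "1 \<le> C"
    and \<epsilon>: "\<And>i. i < m \<Longrightarrow> \<bar>a i (f l)\<bar> \<le> \<epsilon>" "l < m"
  shows "\<bar>Determinant.det (mat m m (\<lambda>(i, j). a i (f j)))\<bar> \<le> fact m * (\<epsilon> * C ^ m)"
proof -
  have prod_le: "(\<Prod>j<m. \<bar>a (p j) (f j)\<bar>) \<le> \<epsilon> * C ^ m" if "p permutes {0..<m}" for p
  proof -
    have p: "p j < m" if "j < m" for j
      using permutes_in_image[OF \<open>p permutes {0..<m}\<close>, of j] that by simp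
    have "(\<Prod>j<m. \<bar>a (p j) (f j)\<bar>)
        = \<bar>a (p l) (f l)\<bar> * (\<Prod>j\<in>{..<m} - {l}. \<bar>a (p j) (f j)\<bar>)"
      using \<epsilon>(2) by (intro prod.remove) auto
    also have "\<dots> \<le> \<epsilon> * C ^ m"
    proof (rule mult_mono)
      have "(\<Prod>j\<in>{..<m} - {l}. \<bar>a (p j) (f j)\<bar>) \<le> (\<Prod>j\<in>{..<m} - {l}. C)"
        by (intro prod_mono) (use C p in auto)
      \<comment> \<open>The product has \<open>m - 1\<close> factors; \<open>1 \<le> C\<close>
        allows the exponent \<open>m\<close>.\<close>
      also have "\<dots> \<le> C ^ m"
        using C(2) \<epsilon>(2) by (simp add: card_Diff_singleton power_increasing)
      finally show "(\<Prod>j\<in>{..<m} - {l}. \<bar>a (p j) (f j)\<bar>) \<le> C ^ m" .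
      show "\<bar>a (p l) (f l)\<bar> \<le> \<epsilon>" using \<epsilon> p by blast
      then show "0 \<le> \<epsilon>" by linarith
    qed (auto intro: prod_nonneg)
    finally show ?thesis .
  qed
  have "Determinant.det (mat m m (\<lambda>(i, j). a i (f j)))
      = (\<Sum>p | p permutes {0..<m}. signof p * (\<Prod>j<m. a (p j) (f j)))"
  proof (subst det_col[where n = m], simp, intro sum.cong refl)
    fix p assume "p \<in> {p. p permutes {0..<m}}"
    then have p: "p j < m" if "j < m" for j
      using permutes_in_image[of p "{0..<m}" j] that by simp
    then show "signof p * (\<Prod>j<m. mat m m (\<lambda>(i, j). a i (f j)) $$ (p j, j))
        = signof p * (\<Prod>j<m. a (p j) (f j))"
      by simp
  qed
  also have "\<bar>\<dots>\<bar> \<le> (\<Sum>p | p permutes {0..<m}. \<epsilon> * C ^ m)"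
  proof (rule order_trans[OF sum_abs sum_mono])
    fix p assume "p \<in> {p. p permutes {0..<m}}"
    then show "\<bar>signof p * (\<Prod>j<m. a (p j) (f j))\<bar> \<le> \<epsilon> * C ^ m"
      using prod_le by (simp add: abs_mult abs_prod sign_def)
  qed
  also have "\<dots> = fact m * (\<epsilon> * C ^ m)"
    by (simp add: card_permutations[OF refl])
  finally show ?thesis .
qed

text \<open>Infinitely many tuples compete, so a maximum need not exist a priori. Since each
  \<open>a i\<close> tends to 0, a tuple with an index beyond some \<open>N\<close> cannot beat
  \<open>f0\<close>. Only finitely many others remain, up to values at arguments
  \<open>\<ge> m\<close>, which the determinant ignores.\<close>

lemma max_det_selection:
  fixes a :: "nat \<Rightarrow> nat \<Rightarrow> real"
  assumes lim: "\<And>i. i < m \<Longrightarrow> a i \<longlonglongrightarrow> 0"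
    and f0: "Determinant.det (mat m m (\<lambda>(i, j). a i (f0 j))) \<noteq> 0"
  obtains f where "Determinant.det (mat m m (\<lambda>(i, j). a i (f j))) \<noteq> 0"
    and "\<And>f'. \<bar>Determinant.det (mat m m (\<lambda>(i, j). a i (f' j)))\<bar>
           \<le> \<bar>Determinant.det (mat m m (\<lambda>(i, j). a i (f j)))\<bar>"
proof -
  define D where "D f = \<bar>Determinant.det (mat m m (\<lambda>(i, j). a i (f j)))\<bar>" for f
  have D_cong: "D f = D f'" if "\<And>j. j < m \<Longrightarrow> f j = f' j" for f f'
    unfolding D_def using that by (auto intro!: arg_cong[where f = "\<lambda>A. \<bar>Determinant.det A\<bar>"])
  have "\<exists>C. \<forall>n. \<bar>a i n\<bar> \<le> C" if "i < m" for i
    using convergent_imp_Bseq[OF convergentI[OF lim[OF that]]] by (auto simp: Bseq_def)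
  then obtain c where c: "\<And>i n. i < m \<Longrightarrow> \<bar>a i n\<bar> \<le> c i"
    by metis
  \<comment> \<open>A common bound for all rows; the summand 1 secures \<open>1 \<le> C\<close>,
    also for \<open>m = 0\<close>.\<close>
  define C where "C = 1 + (\<Sum>i<m. \<bar>c i\<bar>)"
  have C: "\<bar>a i n\<bar> \<le> C" if "i < m" for i n
    using c[OF that, of n] member_le_sum[of i "{..<m}" "\<lambda>i. \<bar>c i\<bar>"] that
    unfolding C_def by (simp; linarith)
  have C1: "1 \<le> C"
    unfolding C_def by (simp add: sum_nonneg)
  \<comment> \<open>Chosen so that the bound \<open>fact m * (\<epsilon> * C ^ m)\<close> of
    \<open>det_selection_bound\<close> is exactly \<open>D f0\<close>.\<close>
  define \<epsilon> where "\<epsilon> = D f0 / (fact m * C ^ m)"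
  have "0 < \<epsilon>"
    unfolding \<epsilon>_def D_def using f0 C1 by simp
  have "eventually (\<lambda>n. \<forall>i\<in>{..<m}. \<bar>a i n\<bar> < \<epsilon>) sequentially"
    using lim \<open>0 < \<epsilon>\<close> by (intro eventually_ball_finite) (auto simp: tendsto_iff dist_real_def)
  then obtain N where N: "\<And>n i. n \<ge> N \<Longrightarrow> i < m \<Longrightarrow> \<bar>a i n\<bar> < \<epsilon>"
    by (auto simp: eventually_sequentially)
  have far: "D f \<le> D f0" if "l < m" "f l \<ge> N" for f l
  proof -
    have "D f \<le> fact m * (\<epsilon> * C ^ m)"
      unfolding D_def using that C C1 N by (intro det_selection_bound[where l = l]) (auto intro: less_imp_le)
    then show ?thesis
      using C1 by (simp add: \<epsilon>_def)
  qed
  \<comment> \<open>Extensional functions make the set of tuples below \<open>N\<close> finite.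
    \<open>f0\<close> is added because it may itself take values outside this range, and every far
    tuple is compared with it.\<close>
  define S where "S = insert f0 ({..<m} \<rightarrow>\<^sub>E {..<N})"
  have "finite S" "S \<noteq> {}"
    unfolding S_def by (auto intro: finite_PiE)
  then obtain f where f: "f \<in> S" "\<And>f'. f' \<in> S \<Longrightarrow> D f' \<le> D f"
    using Max_in[of "D ` S"] Max_ge[of "D ` S"] by fastforce
  have "D f' \<le> D f" for f'
  proof (cases "\<exists>l<m. f' l \<ge> N")
    case True
    then show ?thesis
      using far f(2)[of f0] by (auto simp: S_def intro: order_trans)
  next
    case False
    then have "restrict f' {..<m} \<in> S"
      by (auto simp: S_def not_le)
    then show ?thesis
      using f(2) D_cong[of f' "restrict f' {..<m}"] by simp
  qed
  moreover from this[of f0] have "D f \<noteq> 0"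
    using f0 by (auto simp: D_def)
  ultimately show thesis
    using that by (auto simp: D_def)
qed

text \<open>\<open>B\<close> is the inverse of the matrix of the selected columns, so the sum in the
  last conclusion is the \<open>k\<close>-th coefficient of column \<open>n\<close> expanded in
  these columns. Cramer's rule makes it a quotient of two determinants of selections, the
  denominator being maximal. The tuple \<open>f0\<close> yields the identity matrix and so supplies
  one nonzero determinant.\<close>

lemma bounded_coefficients_selection:
  fixes a :: "nat \<Rightarrow> nat \<Rightarrow> real"
  assumes lim: "\<And>i. i < m \<Longrightarrow> a i \<longlonglongrightarrow> 0"
    and f0: "\<And>i j. i < m \<Longrightarrow> j < m \<Longrightarrow> a i (f0 j) = (if i = j then 1 else 0)"
  obtains f and B :: "nat \<Rightarrow> nat \<Rightarrow> real"
  where "\<And>k l. k < m \<Longrightarrow> l < m \<Longrightarrow> (\<Sum>i<m. B k i * a i (f l)) = (if k = l then 1 else 0)"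
    and "\<And>i l. i < m \<Longrightarrow> l < m \<Longrightarrow> (\<Sum>k<m. a i (f k) * B k l) = (if i = l then 1 else 0)"
    and "\<And>k n. k < m \<Longrightarrow> \<bar>\<Sum>i<m. B k i * a i n\<bar> \<le> 1"
proof -
  define M where "M f = mat m m (\<lambda>(i, j). a i (f j))" for f
  have M: "M f \<in> carrier_mat m m" for f
    by (simp add: M_def)
  have "M f0 = 1\<^sub>m m"
    by (rule eq_matI) (auto simp: M_def f0)
  then have "Determinant.det (M f0) \<noteq> 0"
    by simp
  then obtain f where f: "Determinant.det (M f) \<noteq> 0"
    and max: "\<And>f'. \<bar>Determinant.det (M f')\<bar> \<le> \<bar>Determinant.det (M f)\<bar>"
    using max_det_selection[of m a f0] lim unfolding M_def by blast
  define R where "R = (1 / Determinant.det (M f)) \<cdot>\<^sub>m adj_mat (M f)"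
  have R: "R \<in> carrier_mat m m"
    using adj_mat(1)[OF M] by (simp add: R_def)
  have MR: "M f * R = 1\<^sub>m m" and RM: "R * M f = 1\<^sub>m m"
    using adj_mat[OF M[of f]] f M[of f] mult_smult_distrib[OF M adj_mat(1)[OF M]]
      mult_smult_assoc_mat[OF adj_mat(1)[OF M] M]
    by (auto simp: R_def intro!: eq_matI)
  show thesis
  proof (rule that[where f = f and B = "\<lambda>k i. R $$ (k, i)"])
    fix k l assume kl: "k < m" "l < m"
    have "(R * M f) $$ (k, l) = (\<Sum>i<m. R $$ (k, i) * a i (f l))"
      using kl R M[of f] by (auto simp: times_mat_def scalar_prod_def M_def lessThan_atLeast0)
    then show "(\<Sum>i<m. R $$ (k, i) * a i (f l)) = (if k = l then 1 else 0)"
      using kl by (simp add: RM)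
    have "(M f * R) $$ (k, l) = (\<Sum>i<m. a k (f i) * R $$ (i, l))"
      using kl R M[of f] by (auto simp: times_mat_def scalar_prod_def M_def lessThan_atLeast0)
    then show "(\<Sum>i<m. a k (f i) * R $$ (i, l)) = (if k = l then 1 else 0)"
      using kl by (simp add: MR)
  next
    fix k n assume k: "k < m"
    define b where "b = vec m (\<lambda>i. a i n)"
    have b: "b \<in> carrier_vec m"
      by (simp add: b_def)
    have x: "R *\<^sub>v b \<in> carrier_vec m"
      using R b by simp
    have "M f *\<^sub>v (R *\<^sub>v b) = b"
      using assoc_mult_mat_vec[OF M R b, of f] b by (simp add: MR)
    \<comment> \<open>Putting column \<open>n\<close> in place of the \<open>k\<close>-th selected
      column is again a selection, so maximality of \<open>f\<close> bounds the numerator in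
      Cramer's rule.\<close>
    moreover have "replace_col (M f) b k = M (f(k := n))"
      by (rule eq_matI) (auto simp: replace_col_def M_def b_def)
    ultimately have "Determinant.det (M (f(k := n))) = (R *\<^sub>v b) $ k * Determinant.det (M f)"
      using cramer_lemma_mat[OF M x k, of f] by simp
    then have "\<bar>(R *\<^sub>v b) $ k\<bar> * \<bar>Determinant.det (M f)\<bar> \<le> 1 * \<bar>Determinant.det (M f)\<bar>"
      using max[of "f(k := n)"] by (simp add: abs_mult)
    then have "\<bar>(R *\<^sub>v b) $ k\<bar> \<le> 1"
      using f by (subst (asm) mult_le_cancel_right) auto
    then show "\<bar>\<Sum>i<m. R $$ (k, i) * a i n\<bar> \<le> 1"
      using k R by (simp add: b_def scalar_prod_def lessThan_atLeast0)
  qed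
qed

section \<open>Closed subspaces and bounded coordinates modulo them\<close>

text \<open>For \<open>t \<noteq> 0\<close>, rescaling puts \<open>b - (1 / t) *\<^sub>R v\<close>
  into \<open>S\<close>, so \<open>norm v / \<bar>t\<bar>\<close> is at least the distance from
  \<open>b\<close> to \<open>S\<close>. That distance is positive because \<open>S\<close> is
  closed, and \<open>M\<close> is its reciprocal.\<close>

lemma coefficient_bound_mod_closed_subspace:
  fixes S :: "'a::real_normed_vector set"
  assumes "subspace S" "closed S" "b \<notin> S"
  obtains M where "0 < M" "\<And>t v. v - t *\<^sub>R b \<in> S \<Longrightarrow> \<bar>t\<bar> \<le> M * norm v"
proof
  have "S \<noteq> {}"
    using subspace_0[OF \<open>subspace S\<close>] by auto
  then have pos: "0 < infdist b S"
    using infdist_pos_not_in_closed[OF assms(2)] assms(3) by blast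
  then show "0 < 1 / infdist b S"
    by simp
  fix t v assume v: "v - t *\<^sub>R b \<in> S"
  show "\<bar>t\<bar> \<le> 1 / infdist b S * norm v"
  proof (cases "t = 0")
    case False
    have "(- (1 / t)) *\<^sub>R (v - t *\<^sub>R b) \<in> S"
      using \<open>subspace S\<close> v by (rule subspace_scale)
    then have "b - (1 / t) *\<^sub>R v \<in> S"
      using False by (simp add: algebra_simps)
    then have "infdist b S \<le> dist b (b - (1 / t) *\<^sub>R v)"
      by (rule infdist_le)
    also have "\<dots> = norm v / \<bar>t\<bar>"
      by (simp add: dist_norm)
    finally show ?thesis
      using False pos by (simp add: field_simps)
  qed (use pos in simp)
qed

text \<open>Along a convergent sequence the coefficients of \<open>b\<close> are Cauchy, by the
  preceding bound applied to differences. Once they converge, so do the remainders, whose limit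
  stays in the closed \<open>S\<close>.\<close>

lemma closed_span_insert:
  fixes S :: "'a::real_normed_vector set"
  assumes "subspace S" "closed S"
  shows "closed (span (insert b S))"
proof (cases "b \<in> S")
  case True
  then show ?thesis
    using assms by (metis insert_absorb span_eq_iff)
next
  case False
  have span_S: "span S = S"
    using assms(1) by (simp add: span_eq_iff)
  obtain M where M: "0 < M" "\<And>t v. v - t *\<^sub>R b \<in> S \<Longrightarrow> \<bar>t\<bar> \<le> M * norm v"
    using coefficient_bound_mod_closed_subspace[OF assms False] by blast
  show ?thesis
    unfolding closed_sequential_limits
  proof safe
    fix y :: "nat \<Rightarrow> 'a" and l
    assume "\<forall>n. y n \<in> span (insert b S)" and lim: "y \<longlonglongrightarrow> l"
    then obtain t where t: "\<And>n. y n - t n *\<^sub>R b \<in> S"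
      unfolding span_breakdown_eq span_S by metis
    have "Cauchy t"
    proof (rule metric_CauchyI)
      fix e :: real assume "0 < e"
      then obtain N where N: "\<And>m n. m \<ge> N \<Longrightarrow> n \<ge> N \<Longrightarrow> dist (y m) (y n) < e / M"
        using metric_CauchyD[OF LIMSEQ_imp_Cauchy[OF lim], of "e / M"] M(1) by auto
      have "dist (t m) (t n) < e" if "m \<ge> N" "n \<ge> N" for m n
      proof -
        have "(y m - y n) - (t m - t n) *\<^sub>R b \<in> S"
          using subspace_diff[OF assms(1) t[of m] t[of n]] by (simp add: algebra_simps)
        then have "\<bar>t m - t n\<bar> \<le> M * norm (y m - y n)"
          by (rule M(2))
        also have "\<dots> < e"
          using N[OF that] M(1) by (simp add: dist_norm field_simps)
        finally show ?thesis
          by (simp add: dist_real_def)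
      qed
      then show "\<exists>N. \<forall>m\<ge>N. \<forall>n\<ge>N. dist (t m) (t n) < e"
        by blast
    qed
    then obtain s where "t \<longlonglongrightarrow> s"
      by (auto simp: Cauchy_convergent_iff convergent_def)
    then have "(\<lambda>n. y n - t n *\<^sub>R b) \<longlonglongrightarrow> l - s *\<^sub>R b"
      by (intro tendsto_intros lim)
    with assms(2) t have "l - s *\<^sub>R b \<in> S"
      by (rule closed_sequentially)
    then show "l \<in> span (insert b S)"
      unfolding span_breakdown_eq span_S by blast
  qed
qed

lemma closed_span_Un_finite:
  fixes S :: "'a::real_normed_vector set"
  assumes "subspace S" "closed S" "finite F"
  shows "closed (span (S \<union> F))"
  using assms(3)
proof induction
  case empty
  then show ?case
    using assms by (metis Un_empty_right span_eq_iff)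
next
  case (insert b F)
  have "span (insert b (span (S \<union> F))) = span (insert b (S \<union> F))"
    by (simp only: span_insert span_span)
  then show ?case
    using closed_span_insert[OF subspace_span insert.IH, of b] by simp
qed

text \<open>The Steinitz exchange argument works with a merely dense family because
  every subspace occurring in it is closed.\<close>
lemma finite_subset_spanning_mod_closed_subspace:
  fixes S :: "'a::real_normed_vector set"
  assumes "finite F" "subspace S" "closed S" "V \<subseteq> closure (span E)" "E \<subseteq> V" "V \<subseteq> span (S \<union> F)"
  shows "\<exists>G. finite G \<and> G \<subseteq> E \<and> V \<subseteq> span (S \<union> G)"
  using assms
proof (induction F arbitrary: S)
  case empty
  then show ?case
    by (metis empty_subsetI finite.emptyI)
next
  case (insert b F)
  show ?case
  proof (cases "E \<subseteq> span (S \<union> F)")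
    case True
    then have "closure (span E) \<subseteq> span (S \<union> F)"
      using closed_span_Un_finite[OF insert.prems(1,2) insert.hyps(1)]
      by (intro closure_minimal span_minimal) auto
    then have "V \<subseteq> span (S \<union> F)"
      using insert.prems(3) by (rule subset_trans[rotated])
    then show ?thesis
      using insert.IH[OF insert.prems(1-4)] by simp
  next
    case False
    then obtain e where e: "e \<in> E" "e \<notin> span (S \<union> F)"
      by blast
    \<comment> \<open>Exchange \<open>b\<close> for \<open>e\<close>: moving \<open>e\<close> into
      the subspace leaves only \<open>F\<close> to be replaced, which is why the induction keeps
      \<open>S\<close> arbitrary.\<close>
    define S' where "S' = span (insert e S)"
    have "e \<in> span (insert b (S \<union> F))"
      using subsetD[OF insert.prems(5)] subsetD[OF insert.prems(4) e(1)] by simp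
    then have "b \<in> span (insert e (S \<union> F))"
      using e(2) by (rule in_span_insert)
    then have "insert b (S \<union> F) \<subseteq> span (insert e (S \<union> F))"
      by (meson insert_subset span_superset subset_insertI subset_trans)
    then have "span (insert b (S \<union> F)) \<subseteq> span (insert e (S \<union> F))"
      by (rule span_minimal) simp
    also have "\<dots> \<subseteq> span (S' \<union> F)"
      unfolding S'_def by (rule span_mono) (use span_superset[of "insert e S"] in blast)
    finally have "V \<subseteq> span (S' \<union> F)"
      using insert.prems(5) by simp
    moreover have "subspace S'" "closed S'"
      unfolding S'_def using insert.prems by (simp_all only: subspace_span closed_span_insert)
    ultimately obtain G where G: "finite G" "G \<subseteq> E" "V \<subseteq> span (S' \<union> G)"
      using insert.IH[of S', OF _ _ insert.prems(3,4)] by blast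
    have "S' \<subseteq> span (S \<union> insert e G)"
      unfolding S'_def by (rule span_mono) blast
    moreover have "G \<subseteq> span (S \<union> insert e G)"
      by (meson UnI2 insertI2 span_base subsetI)
    ultimately have "span (S' \<union> G) \<subseteq> span (S \<union> insert e G)"
      by (intro span_minimal subspace_span) simp
    then have "V \<subseteq> span (S \<union> insert e G)"
      using G(3) by (rule subset_trans[rotated])
    then show ?thesis
      using G(1,2) e(1) by (intro exI[of _ "insert e G"]) simp
  qed
qed

text \<open>Take \<open>G\<close> inclusion-minimal among the subsets of \<open>F\<close> that still
  span; a redundant element could be dropped. The last conclusion is linear independence modulo the
  span of \<open>S\<close>.\<close>

lemma minimal_spanning_mod_subspace:
  assumes "finite F" "V \<subseteq> span (S \<union> F)"
  obtains G where "finite G" "G \<subseteq> F" "V \<subseteq> span (S \<union> G)"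
    "\<And>b. b \<in> G \<Longrightarrow> b \<notin> span (S \<union> (G - {b}))"
proof -
  define \<A> where "\<A> = {G. G \<subseteq> F \<and> V \<subseteq> span (S \<union> G)}"
  have "\<A> \<subseteq> Pow F" "F \<in> \<A>"
    using assms(2) by (simp_all add: \<A>_def Collect_mono_iff Pow_def)
  then obtain G where G: "G \<in> \<A>" "\<And>H. H \<in> \<A> \<Longrightarrow> H \<subseteq> G \<Longrightarrow> G = H"
    using finite_has_minimal2[of \<A> F] finite_subset[of \<A> "Pow F"] assms(1) by (metis finite_Pow_iff)
  have GF: "G \<subseteq> F" and VG: "V \<subseteq> span (S \<union> G)"
    using G(1) by (simp_all add: \<A>_def)
  have "b \<notin> span (S \<union> (G - {b}))" if "b \<in> G" for b
  proof
    assume "b \<in> span (S \<union> (G - {b}))"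
    then have "span (insert b (S \<union> (G - {b}))) = span (S \<union> (G - {b}))"
      by (rule span_redundant)
    moreover have "insert b (S \<union> (G - {b})) = S \<union> G"
      using that by blast
    ultimately have "G - {b} \<in> \<A>"
      using GF VG by (simp add: \<A>_def Diff_subset[THEN subset_trans])
    then have "G = G - {b}"
      by (rule G(2)) blast
    then show False
      using that by blast
  qed
  then show thesis
    by (intro that[of G] GF VG finite_subset[OF GF assms(1)])
qed

text \<open>The coordinate of \<open>v\<close> at \<open>b\<close> is the coefficient of
  \<open>b\<close> modulo \<open>H b\<close>, the span of \<open>S\<close> and the remaining vectors
  of \<open>F\<close>. Independence makes it unique, which gives linearity; closedness of
  \<open>H b\<close> makes it bounded.\<close>

lemma bounded_coordinates_mod_closed_subspace:
  fixes S :: "'a::real_normed_vector set"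
  assumes S: "subspace S" "closed S" and V: "subspace V"
    and F: "finite F" "F \<subseteq> V" "V \<subseteq> span (S \<union> F)"
    and indep: "\<And>b. b \<in> F \<Longrightarrow> b \<notin> span (S \<union> (F - {b}))"
  obtains \<phi> where "\<And>b v w. b \<in> F \<Longrightarrow> v \<in> V \<Longrightarrow> w \<in> V \<Longrightarrow> \<phi> b (v + w) = \<phi> b v + \<phi> b w"
    and "\<And>b c v. b \<in> F \<Longrightarrow> v \<in> V \<Longrightarrow> \<phi> b (c *\<^sub>R v) = c * \<phi> b v"
    and "\<And>b. b \<in> F \<Longrightarrow> \<exists>M. \<forall>v\<in>V. \<bar>\<phi> b v\<bar> \<le> M * norm v"
    and "\<And>b b'. b \<in> F \<Longrightarrow> b' \<in> F \<Longrightarrow> \<phi> b b' = (if b = b' then 1 else 0)"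
    and "\<And>v. v \<in> V \<Longrightarrow> v \<in> S \<longleftrightarrow> (\<forall>b\<in>F. \<phi> b v = 0)"
proof -
  define H where "H b = span (S \<union> (F - {b}))" for b
  have H: "subspace (H b)" "closed (H b)" for b
    using closed_span_Un_finite[OF S, of "F - {b}"] F(1) by (auto simp: H_def)
  have not_H: "b \<notin> H b" if "b \<in> F" for b
    using indep[OF that] by (simp add: H_def)
  have "\<exists>t. v - t *\<^sub>R b \<in> H b" if "b \<in> F" "v \<in> V" for b v
  proof -
    have "S \<union> F = insert b (S \<union> (F - {b}))"
      using that by auto
    then have "v \<in> span (insert b (S \<union> (F - {b})))"
      using that F(3) by auto
    then show ?thesis
      unfolding span_breakdown_eq H_def .
  qed
  then obtain \<phi> where \<phi>: "\<And>b v. b \<in> F \<Longrightarrow> v \<in> V \<Longrightarrow> v - \<phi> b v *\<^sub>R b \<in> H b"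
    by metis
  \<comment> \<open>Two different coefficients would put a nonzero multiple of \<open>b\<close> into
    \<open>H b\<close>. The algebraic properties of \<open>\<phi>\<close> all follow by exhibiting
    an admissible coefficient and invoking this uniqueness.\<close>
  have uniq: "\<phi> b v = t" if "b \<in> F" "v \<in> V" "v - t *\<^sub>R b \<in> H b" for b v t
  proof (rule ccontr)
    assume "\<phi> b v \<noteq> t"
    have "(v - t *\<^sub>R b) - (v - \<phi> b v *\<^sub>R b) \<in> H b"
      using H(1) that(3) \<phi>[OF that(1,2)] by (rule subspace_diff)
    moreover have "(v - t *\<^sub>R b) - (v - \<phi> b v *\<^sub>R b) = (\<phi> b v - t) *\<^sub>R b"
      by (simp add: algebra_simps)
    ultimately have "(\<phi> b v - t) *\<^sub>R b \<in> H b"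
      by simp
    then have "(1 / (\<phi> b v - t)) *\<^sub>R ((\<phi> b v - t) *\<^sub>R b) \<in> H b"
      by (rule subspace_scale[OF H(1)])
    then show False
      using \<open>\<phi> b v \<noteq> t\<close> not_H[OF that(1)] by simp
  qed
  have S_H: "S \<subseteq> H b" for b
    unfolding H_def by (rule subset_trans[OF _ span_superset]) simp
  have F_H: "b' \<in> H b" if "b' \<in> F" "b' \<noteq> b" for b b'
    unfolding H_def using that by (simp add: span_base)
  show thesis
  proof
    fix b v w assume "b \<in> F" "v \<in> V" "w \<in> V"
    then show "\<phi> b (v + w) = \<phi> b v + \<phi> b w"
      using subspace_add[OF H(1) \<phi>[of b v] \<phi>[of b w]] subspace_add[OF V]
      by (intro uniq) (simp_all add: scaleR_add_left add_diff_add)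
  next
    fix b c v assume "b \<in> F" "v \<in> V"
    then show "\<phi> b (c *\<^sub>R v) = c * \<phi> b v"
      using subspace_scale[OF H(1) \<phi>[of b v], of c] subspace_scale[OF V]
      by (intro uniq) (simp_all add: scaleR_diff_right)
  next
    fix b assume b: "b \<in> F"
    obtain M where "\<And>t v. v - t *\<^sub>R b \<in> H b \<Longrightarrow> \<bar>t\<bar> \<le> M * norm v"
      using coefficient_bound_mod_closed_subspace[OF H not_H[OF b]] by blast
    then have "\<forall>v\<in>V. \<bar>\<phi> b v\<bar> \<le> M * norm v"
      using \<phi>[OF b] by simp
    then show "\<exists>M. \<forall>v\<in>V. \<bar>\<phi> b v\<bar> \<le> M * norm v" ..
  next
    fix b b' assume "b \<in> F" "b' \<in> F"
    then show "\<phi> b b' = (if b = b' then 1 else 0)"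
      using F_H[of b' b] subsetD[OF F(2)] subspace_0[OF H(1)] by (intro uniq) simp_all
  next
    fix v assume v: "v \<in> V"
    show "v \<in> S \<longleftrightarrow> (\<forall>b\<in>F. \<phi> b v = 0)"
    proof
      assume "v \<in> S"
      then have "\<phi> b v = 0" if "b \<in> F" for b
        using uniq[OF that v, of 0] subsetD[OF S_H] by simp
      then show "\<forall>b\<in>F. \<phi> b v = 0" ..
    next
      assume zero: "\<forall>b\<in>F. \<phi> b v = 0"
      have "v \<in> {x + y |x y. x \<in> span S \<and> y \<in> span F}"
        using subsetD[OF F(3) v] unfolding span_Un .
      then obtain x y where "x \<in> span S" "y \<in> span F" "v = x + y"
        by blast
      moreover from \<open>y \<in> span F\<close> obtain u where "y = (\<Sum>b\<in>F. u b *\<^sub>R b)"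
        unfolding span_finite[OF F(1)] by blast
      ultimately have x: "x \<in> S" "v = x + (\<Sum>b\<in>F. u b *\<^sub>R b)"
        using S(1) by (simp_all only: span_eq_iff[THEN iffD2])
      \<comment> \<open>The coefficients of the decomposition are the coordinates of
        \<open>v\<close>, which vanish here; so \<open>v\<close> equals its component
        \<open>x\<close> in \<open>S\<close>.\<close>
      have "\<phi> b v = u b" if "b \<in> F" for b
      proof (rule uniq[OF that v])
        have "v - u b *\<^sub>R b = x + (\<Sum>b\<in>F - {b}. u b *\<^sub>R b)"
          using x(2) sum.remove[OF F(1) that, of "\<lambda>b. u b *\<^sub>R b"] by simp
        also have "\<dots> \<in> H b"
          using subsetD[OF S_H x(1)] F_H[of _ b]
          by (intro subspace_add subspace_sum subspace_scale H(1)) simp_all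
        finally show "v - u b *\<^sub>R b \<in> H b" .
      qed
      then show "v \<in> S"
        using x zero by simp
    qed
  qed
qed

section \<open>Unit vectors of \<open>c0\<close> and bounded functionals on them\<close>

definition unit_seq :: "nat \<Rightarrow> (nat \<Rightarrow>\<^sub>C real)" where
  "unit_seq n = Bcontfun (\<lambda>k. if k = n then 1 else 0)"

lemma apply_unit_seq [simp]: "apply_bcontfun (unit_seq n) k = (if k = n then 1 else 0)"
proof -
  have "(\<lambda>k. if k = n then 1 else 0 :: real) \<in> bcontfun"
    by (rule bcontfun_normI[where b = 1]) auto
  then show ?thesis
    by (simp add: unit_seq_def Bcontfun_inverse)
qed

lemma unit_seq_in_c0: "unit_seq n \<in> c0"
  unfolding c0_def
  by (auto intro!: tendsto_eventually eventually_sequentiallyI[of "Suc n"])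

lemma apply_bcontfun_sum:
  fixes g :: "'i \<Rightarrow> nat \<Rightarrow>\<^sub>C real"
  shows "apply_bcontfun (\<Sum>i\<in>A. g i) n = (\<Sum>i\<in>A. apply_bcontfun (g i) n)"
  by (induction A rule: infinite_finite_induct) auto

text \<open>Up to sign, the error of a partial sum is a tail of \<open>y\<close>, and the supremum
  of the tail tends to 0 because \<open>y\<close> does.\<close>

lemma c0_expansion:
  assumes "y \<in> c0"
  shows "(\<lambda>N. \<Sum>k<N. apply_bcontfun y k *\<^sub>R unit_seq k) \<longlonglongrightarrow> y"
proof (rule LIMSEQ_I)
  fix e :: real assume "0 < e"
  then obtain N where N: "\<And>n. n \<ge> N \<Longrightarrow> \<bar>apply_bcontfun y n\<bar> < e / 2"
    using assms LIMSEQ_D[of "apply_bcontfun y" 0 "e / 2"] by (auto simp: c0_def)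
  have "norm ((\<Sum>k<n. apply_bcontfun y k *\<^sub>R unit_seq k) - y) < e" if "n \<ge> N" for n
  proof -
    \<comment> \<open>A bound on all coordinates passes to the supremum only as
      \<open>\<le>\<close>; working with \<open>e / 2\<close> keeps the final inequality
      strict.\<close>
    have "norm ((\<Sum>k<n. apply_bcontfun y k *\<^sub>R unit_seq k) - y) \<le> e / 2"
    proof (rule norm_bound)
      fix j
      have "(\<Sum>k<n. apply_bcontfun y k * (if j = k then 1 else 0))
          = (if j < n then apply_bcontfun y j else 0)"
        by (simp add: if_distrib[of "(*) _"] cong: if_cong)
      then show "norm (apply_bcontfun ((\<Sum>k<n. apply_bcontfun y k *\<^sub>R unit_seq k) - y) j) \<le> e / 2"
        using N[of j] that \<open>0 < e\<close> by (auto simp: apply_bcontfun_sum)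
    qed
    then show ?thesis
      using \<open>0 < e\<close> by simp
  qed
  then show "\<exists>no. \<forall>n\<ge>no. norm ((\<Sum>k<n. apply_bcontfun y k *\<^sub>R unit_seq k) - y) < e"
    by blast
qed

lemma c0_subset_closure_span_unit_seq: "c0 \<subseteq> closure (span (range unit_seq))"
proof
  fix y assume "y \<in> c0"
  then show "y \<in> closure (span (range unit_seq))"
    unfolding closure_sequential
    using c0_expansion[of y]
    by (intro exI[of _ "\<lambda>N. \<Sum>k<N. apply_bcontfun y k *\<^sub>R unit_seq k"])
      (simp add: span_sum span_scale span_base)
qed

text \<open>As in the duality of \<open>c0\<close> with l^1, the values on the unit vectors are
  absolutely summable, because finite sign combinations of unit vectors have norm at most 1. Hence
  they tend to 0.\<close>

lemma unit_seq_tendsto_0: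
  assumes add: "\<And>v w. v \<in> c0 \<Longrightarrow> w \<in> c0 \<Longrightarrow> \<phi> (v + w) = \<phi> v + \<phi> w"
    and scale: "\<And>c v. v \<in> c0 \<Longrightarrow> \<phi> (c *\<^sub>R v) = c * \<phi> v"
    and M: "\<And>v. v \<in> c0 \<Longrightarrow> \<bar>\<phi> v\<bar> \<le> M * norm v"
  shows "(\<lambda>n. \<phi> (unit_seq n)) \<longlonglongrightarrow> 0"
proof -
  have sum_c0: "(\<Sum>k\<in>A. c k *\<^sub>R unit_seq k) \<in> c0" for A :: "nat set" and c
    by (intro subspace_sum subspace_scale subspace_c0 unit_seq_in_c0)
  have sum: "\<phi> (\<Sum>k<N. c k *\<^sub>R unit_seq k) = (\<Sum>k<N. c k * \<phi> (unit_seq k))" for N :: nat and c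
  proof (induction N)
    case 0
    show ?case
      using scale[of 0 0] subspace_0[OF subspace_c0] by simp
  next
    case (Suc N)
    then show ?case
      using sum_c0 by (simp add: add scale unit_seq_in_c0 subspace_scale[OF subspace_c0])
  qed
  have "(\<Sum>k<N. \<bar>\<phi> (unit_seq k)\<bar>) \<le> \<bar>M\<bar>" for N
  proof -
    \<comment> \<open>These signs turn \<open>\<phi> v\<close> into the sum of the absolute values
      while every coordinate of \<open>v\<close> stays in [-1, 1].\<close>
    define c where "c k = sgn (\<phi> (unit_seq k))" for k
    define v where "v = (\<Sum>k<N. c k *\<^sub>R unit_seq k)"
    have "norm v \<le> 1"
    proof (rule norm_bound)
      fix j
      have "(\<Sum>k<N. c k * (if j = k then 1 else 0)) = (if j < N then c j else 0)"
        by (simp add: if_distrib[of "(*) _"] cong: if_cong)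
      then show "norm (apply_bcontfun v j) \<le> 1"
        by (auto simp: v_def apply_bcontfun_sum c_def sgn_if)
    qed
    have "(\<Sum>k<N. \<bar>\<phi> (unit_seq k)\<bar>) = \<phi> v"
      unfolding v_def sum by (intro sum.cong) (auto simp: c_def sgn_if)
    also have "\<dots> \<le> M * norm v"
      using M[of v] sum_c0[of c "{..<N}"] by (simp add: v_def)
    also have "\<dots> \<le> \<bar>M\<bar> * 1"
      using \<open>norm v \<le> 1\<close> by (intro mult_mono) auto
    finally show ?thesis by simp
  qed
  then have "summable (\<lambda>n. \<bar>\<phi> (unit_seq n)\<bar>)"
    by (intro summableI_nonneg_bounded[where x = "\<bar>M\<bar>"]) auto
  then show ?thesis
    using summable_LIMSEQ_zero tendsto_rabs_zero_iff by blast
qed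

section \<open>The projection onto \<open>X\<close> and the Auerbach basis\<close>

text \<open>The \<open>g k\<close> are dual to the selected unit vectors and have common kernel
  \<open>X\<close> in \<open>c0\<close>, so \<open>P\<close> projects \<open>c0\<close> onto
  \<open>X\<close> along these vectors. For \<open>n\<close> outside \<open>J\<close>,
  \<open>P (unit_seq n)\<close> has coordinate 1 at \<open>n\<close>, coordinates
  \<open>- g l (unit_seq n)\<close> at the \<open>f l\<close>, and 0 elsewhere; \<open>le1\<close>
  then gives norm 1. Evaluations at positions outside \<open>J\<close> are biorthogonal to these
  vectors.\<close>

lemma auerbach_basis_of_coordinates:
  fixes X :: "(nat \<Rightarrow>\<^sub>C real) set" and g :: "nat \<Rightarrow> (nat \<Rightarrow>\<^sub>C real) \<Rightarrow> real"
  assumes X: "subspace X" "X \<subseteq> c0" "closed X"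
    and add: "\<And>k v w. k < m \<Longrightarrow> v \<in> c0 \<Longrightarrow> w \<in> c0 \<Longrightarrow> g k (v + w) = g k v + g k w"
    and scale: "\<And>k c v. k < m \<Longrightarrow> v \<in> c0 \<Longrightarrow> g k (c *\<^sub>R v) = c * g k v"
    and bdd: "\<And>k. k < m \<Longrightarrow> \<exists>M. \<forall>v\<in>c0. \<bar>g k v\<bar> \<le> M * norm v"
    and bio: "\<And>k l. k < m \<Longrightarrow> l < m \<Longrightarrow> g k (unit_seq (f l)) = (if k = l then 1 else 0)"
    and mem: "\<And>v. v \<in> c0 \<Longrightarrow> v \<in> X \<longleftrightarrow> (\<forall>k<m. g k v = 0)"
    and le1: "\<And>k n. k < m \<Longrightarrow> \<bar>g k (unit_seq n)\<bar> \<le> 1"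
  shows "\<exists>x h. auerbach_basis X x h"
proof -
  define J where "J = f ` {..<m}"
  \<comment> \<open>The basis is indexed by all naturals, so the complement of the finite set
    \<open>J\<close> is listed in increasing order.\<close>
  define r where "r = enumerate (- J)"
  have "infinite (- J)"
    by (simp add: J_def finite_compl[symmetric] Compl_eq_Diff_UNIV[symmetric])
  then have r: "bij_betw r UNIV (- J)"
    unfolding r_def by (rule bij_enumerate)
  have r_J: "r n \<notin> J" for n
    using bij_betwE[OF r] by blast
  have r_eq: "r n = r n' \<longleftrightarrow> n = n'" for n n'
    using bij_betw_imp_inj_on[OF r] by (auto simp: inj_on_def)
  define P where "P v = v - (\<Sum>k<m. g k v *\<^sub>R unit_seq (f k))" for v
  have sum_c0: "(\<Sum>k\<in>A. c k *\<^sub>R unit_seq (q k)) \<in> c0" for A :: "nat set" and c q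
    by (intro subspace_sum subspace_scale subspace_c0 unit_seq_in_c0)
  have g_sum: "g k (\<Sum>l<N. c l *\<^sub>R unit_seq (q l)) = (\<Sum>l<N. c l * g k (unit_seq (q l)))"
    if "k < m" for k N :: nat and c q
  proof (induction N)
    case 0
    show ?case
      using scale[OF that, of 0 0] subspace_0[OF subspace_c0] by simp
  next
    case (Suc N)
    then show ?case
      using sum_c0 that
      by (simp add: add scale unit_seq_in_c0 subspace_scale[OF subspace_c0])
  qed
  have P_c0: "P v \<in> c0" if "v \<in> c0" for v
    unfolding P_def using that sum_c0 by (intro subspace_diff subspace_c0) auto
  have P_X: "P v \<in> X" if v: "v \<in> c0" for v
  proof -
    have "g k (P v) = 0" if k: "k < m" for k
    proof -
      have "g k (P v + (\<Sum>l<m. g l v *\<^sub>R unit_seq (f l)))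
          = g k (P v) + (\<Sum>l<m. g l v * (if k = l then 1 else 0))"
        using k sum_c0 P_c0[OF v] by (simp add: add g_sum bio)
      also have "\<dots> = g k (P v) + g k v"
        using k by (simp add: if_distrib[of "(*) _"] cong: if_cong)
      finally show ?thesis
        by (simp add: P_def)
    qed
    then show ?thesis
      using mem P_c0[OF v] by blast
  qed
  have P_id: "P v = v" if "v \<in> X" for v
    using mem[of v] X(2) that by (auto simp: P_def)
  have P_J: "P (unit_seq n) = 0" if "n \<in> J" for n
  proof -
    obtain l where l: "l < m" "n = f l"
      using \<open>n \<in> J\<close> unfolding J_def by blast
    have "(\<Sum>k<m. g k (unit_seq (f l)) *\<^sub>R unit_seq (f k))
        = (\<Sum>k<m. if k = l then unit_seq (f k) else 0)"
      using l by (intro sum.cong) (auto simp: bio)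
    then show ?thesis
      using l by (simp add: P_def)
  qed
  \<comment> \<open>A repeated index would force \<open>bio\<close> to give 1 and 0 for the same
    value. Thus only one summand of \<open>P\<close> contributes at position
    \<open>f l\<close>.\<close>
  have inj_f: "k = l" if "k < m" "l < m" "f k = f l" for k l
    using bio[of k k] bio[of k l] that by (auto split: if_splits)
  define x where "x n = P (unit_seq (r n))" for n
  have x_X: "x n \<in> X" for n
    unfolding x_def by (intro P_X unit_seq_in_c0)
  have x_r: "apply_bcontfun (x n) (r k) = (if k = n then 1 else 0)" for n k
  proof -
    have "r k \<noteq> f l" if "l < m" for l
      using r_J[of k] that by (auto simp: J_def)
    then show ?thesis
      by (simp add: x_def P_def apply_bcontfun_sum r_eq)
  qed
  have x_f: "apply_bcontfun (x n) (f l) = - g l (unit_seq (r n))" if "l < m" for n l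
  proof -
    have "(\<Sum>k<m. g k (unit_seq (r n)) * (if f l = f k then 1 else 0))
        = (\<Sum>k<m. if k = l then g k (unit_seq (r n)) else 0)"
      using inj_f that by (intro sum.cong) auto
    moreover have "f l \<in> J"
      using that by (simp add: J_def)
    then have "f l \<noteq> r n"
      using r_J[of n] by metis
    ultimately show ?thesis
      using that by (simp add: x_def P_def apply_bcontfun_sum)
  qed
  have norm_x: "norm (x n) = 1" for n
  proof (rule antisym)
    show "norm (x n) \<le> 1"
    proof (rule norm_bound)
      fix j
      show "norm (apply_bcontfun (x n) j) \<le> 1"
      proof (cases "j \<in> J")
        case True
        then show ?thesis
          using x_f le1 by (auto simp: J_def)
      next
        case False
        then obtain k where "j = r k"
          using r by (auto simp: bij_betw_def)
        then show ?thesis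
          by (simp add: x_r)
      qed
    qed
    show "1 \<le> norm (x n)"
      using norm_bounded[of "x n" "r n"] by (simp add: x_r)
  qed
  \<comment> \<open>Coordinate evaluation has norm at most 1 on all bounded sequences; on
    \<open>X\<close> the value 1 is attained at \<open>x n\<close>.\<close>
  define h where "h n y = apply_bcontfun y (r n)" for n and y :: "nat \<Rightarrow>\<^sub>C real"
  have h_le: "\<bar>h n y\<bar> \<le> norm y" for n y
    using norm_bounded[of y "r n"] by (simp add: h_def)
  have h_dual: "h n \<in> dual_on X" for n
  proof -
    have "bounded_linear (h n)"
      using h_le by (intro bounded_linear_intro[where K = 1]) (auto simp: h_def)
    then have "continuous_on X (h n)"
      by (rule linear_continuous_on)
    then show ?thesis
      by (simp add: dual_on_def h_def[abs_def])
  qed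
  have h_norm: "dual_norm_on X (h n) = 1" for n
    unfolding dual_norm_on_def
  proof (rule cSup_eq_maximum)
    have "\<bar>h n (x n)\<bar> = 1"
      by (simp add: h_def x_r)
    then show "1 \<in> (\<lambda>y. \<bar>h n y\<bar>) ` {y \<in> X. norm y \<le> 1}"
      using x_X norm_x by (intro image_eqI[of _ _ "x n"]) auto
  next
    fix t assume "t \<in> (\<lambda>y. \<bar>h n y\<bar>) ` {y \<in> X. norm y \<le> 1}"
    then obtain y where "norm y \<le> 1" "t = \<bar>h n y\<bar>"
      by blast
    then show "t \<le> 1"
      using h_le[of n y] by simp
  qed
  \<comment> \<open>The image under \<open>P\<close> of the partial sums of \<open>y\<close>. Terms
    with \<open>k \<in> J\<close> vanish and the others are multiples of basis vectors, so
    convergence of \<open>s y\<close> to \<open>y\<close> serves both totality and density.\<close>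
  define s where "s y N = (\<Sum>k<N. apply_bcontfun y k *\<^sub>R P (unit_seq k))" for y N
  have P_sum: "P (\<Sum>k<N. apply_bcontfun y k *\<^sub>R unit_seq k) = s y N" for y N
  proof -
    have "(\<Sum>l<m. g l (\<Sum>k<N. apply_bcontfun y k *\<^sub>R unit_seq k) *\<^sub>R unit_seq (f l))
        = (\<Sum>l<m. \<Sum>k<N. (apply_bcontfun y k * g l (unit_seq k)) *\<^sub>R unit_seq (f l))"
      by (intro sum.cong) (auto simp: g_sum[where q = "\<lambda>k. k"] scaleR_sum_left)
    also have "\<dots> = (\<Sum>k<N. \<Sum>l<m. (apply_bcontfun y k * g l (unit_seq k)) *\<^sub>R unit_seq (f l))"
      by (rule sum.swap)
    finally show ?thesis
      by (simp add: P_def s_def scaleR_diff_right sum_subtractf scaleR_sum_right)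
  qed
  have s_lim: "s y \<longlonglongrightarrow> y" if y: "y \<in> X" for y
  proof -
    define p where "p N = (\<Sum>k<N. apply_bcontfun y k *\<^sub>R unit_seq k)" for N
    have y_c0: "y \<in> c0"
      using X(2) y by (rule subsetD)
    have p_lim: "p \<longlonglongrightarrow> y"
      unfolding p_def[abs_def] using y_c0 by (rule c0_expansion)
    have p_c0: "p N \<in> c0" for N
      unfolding p_def by (rule sum_c0)
    have g_lim: "(\<lambda>N. g l (p N)) \<longlonglongrightarrow> 0" if l: "l < m" for l
    proof -
      obtain M where M: "\<And>v. v \<in> c0 \<Longrightarrow> \<bar>g l v\<bar> \<le> M * norm v"
        using bdd[OF l] by metis
      have "(\<lambda>N. M * norm (p N - y)) \<longlonglongrightarrow> M * norm (y - y)"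
        by (intro tendsto_mult tendsto_norm tendsto_diff tendsto_const p_lim)
      then have lim0: "(\<lambda>N. M * norm (p N - y)) \<longlonglongrightarrow> 0"
        by simp
      \<comment> \<open>As \<open>g l\<close> vanishes at \<open>y\<close>, its value at
        \<open>p N\<close> is that at \<open>p N - y\<close>, which the bound controls.\<close>
      have "norm (g l (p N)) \<le> M * norm (p N - y)" for N
      proof -
        have "g l y = 0"
          using mem[OF y_c0] y l by metis
        moreover have d: "p N - y \<in> c0"
          using p_c0 y_c0 by (rule subspace_diff[OF subspace_c0])
        moreover have "g l (p N) = g l (p N - y) + g l y"
          using add[OF l d y_c0] by simp
        ultimately show ?thesis
          using M[OF d] by simp
      qed
      then show ?thesis
        by (intro Lim_null_comparison[OF always_eventually lim0] allI)
    qed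
    \<comment> \<open>The finitely many correction terms tend to 0, so \<open>P (p N)\<close> has
      the same limit as \<open>p N\<close>.\<close>
    have "(\<lambda>N. P (p N)) \<longlonglongrightarrow> y - (\<Sum>k<m. 0 *\<^sub>R unit_seq (f k))"
      unfolding P_def
      by (intro tendsto_diff tendsto_sum tendsto_scaleR tendsto_const p_lim g_lim) simp
    then show ?thesis
      by (simp add: p_def P_sum)
  qed
  have total: "y = 0" if y: "y \<in> X" "\<forall>n. h n y = 0" for y
  proof -
    \<comment> \<open>For \<open>k\<close> in \<open>J\<close> the vector vanishes, for all other
      \<open>k\<close> the coefficient does.\<close>
    have "apply_bcontfun y k *\<^sub>R P (unit_seq k) = 0" for k
    proof (cases "k \<in> J")
      case False
      then obtain n where "k = r n"
        using r by (auto simp: bij_betw_def)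
      then show ?thesis
        using y(2) by (simp add: h_def)
    qed (simp add: P_J)
    then have "s y = (\<lambda>N. 0)"
      by (simp add: s_def fun_eq_iff del: scaleR_eq_0_iff)
    then have "s y \<longlonglongrightarrow> 0"
      by simp
    then show ?thesis
      by (rule LIMSEQ_unique[OF s_lim[OF y(1)]])
  qed
  have "closure (span (range x)) = X"
  proof
    show "closure (span (range x)) \<subseteq> X"
      using x_X by (intro closure_minimal span_minimal X image_subsetI)
    show "X \<subseteq> closure (span (range x))"
    proof
      fix y assume y: "y \<in> X"
      have "P (unit_seq k) \<in> span (range x)" for k
      proof (cases "k \<in> J")
        case True
        then show ?thesis
          by (simp add: P_J span_zero)
      next
        case False
        then obtain n where "k = r n"
          using r by (auto simp: bij_betw_def)
        then show ?thesis
          unfolding x_def by (intro span_base) simp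
      qed
      then have "s y N \<in> span (range x)" for N
        unfolding s_def by (intro span_sum span_scale)
      then show "y \<in> closure (span (range x))"
        using s_lim[OF y] unfolding closure_sequential by (intro exI[of _ "s y"] conjI allI)
    qed
  qed
  moreover have "h k (x j) = (if k = j then 1 else 0)" for k j
    by (simp add: h_def x_r)
  ultimately have "auerbach_basis X x h"
    unfolding auerbach_basis_def using x_X h_dual total norm_x h_norm by simp
  then show ?thesis by blast
qed

section \<open>From finite codimension to the selected coordinates\<close>

theorem theorem2p1:
  fixes X :: "(nat \<Rightarrow>\<^sub>C real) set"
  assumes "subspace X" and "X \<subseteq> c0" and "closed X" and "finite_codim X c0"
  shows "\<exists>x f. auerbach_basis X x f"
proof -
  obtain F\<^sub>0 where F\<^sub>0: "finite F\<^sub>0" "\<And>v. v \<in> c0 \<Longrightarrow> \<exists>u\<in>span F\<^sub>0. v - u \<in> X"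
    using assms(4) unfolding finite_codim_def by metis
  have "c0 \<subseteq> span (X \<union> F\<^sub>0)"
  proof
    fix v :: "nat \<Rightarrow>\<^sub>C real" assume "v \<in> c0"
    then obtain u where u: "u \<in> span F\<^sub>0" "v - u \<in> X"
      using F\<^sub>0(2) by metis
    have "(v - u) + u \<in> span (X \<union> F\<^sub>0)"
    proof (rule span_add)
      show "v - u \<in> span (X \<union> F\<^sub>0)"
        using u(2) by (simp add: span_base)
      show "u \<in> span (X \<union> F\<^sub>0)"
        using span_mono[of F\<^sub>0 "X \<union> F\<^sub>0"] u(1) by blast
    qed
    then show "v \<in> span (X \<union> F\<^sub>0)"
      by simp
  qed
  moreover have "range unit_seq \<subseteq> c0"
    using unit_seq_in_c0 by blast
  \<comment> \<open>The vectors spanning \<open>c0\<close> modulo \<open>X\<close> are exchanged for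
    unit vectors, whose span is dense in \<open>c0\<close>. These will provide the initial tuple for
    the determinant argument.\<close>
  ultimately obtain G where "finite G" "G \<subseteq> range unit_seq" "c0 \<subseteq> span (X \<union> G)"
    using finite_subset_spanning_mod_closed_subspace[OF F\<^sub>0(1) assms(1,3)
        c0_subset_closure_span_unit_seq] by metis
  moreover from this(1,3) obtain F where F: "finite F" "F \<subseteq> G" "c0 \<subseteq> span (X \<union> F)"
      "\<And>b. b \<in> F \<Longrightarrow> b \<notin> span (X \<union> (F - {b}))"
    by (rule minimal_spanning_mod_subspace) blast
  ultimately have F_unit: "F \<subseteq> range unit_seq"
    by simp
  then have F_c0: "F \<subseteq> c0"
    using unit_seq_in_c0 by blast
  obtain \<phi> where
        \<phi>_add: "\<And>b v w. b \<in> F \<Longrightarrow> v \<in> c0 \<Longrightarrow> w \<in> c0 \<Longrightarrow> \<phi> b (v + w) = \<phi> b v + \<phi> b w"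
    and \<phi>_scale: "\<And>b c v. b \<in> F \<Longrightarrow> v \<in> c0 \<Longrightarrow> \<phi> b (c *\<^sub>R v) = c * \<phi> b v"
    and \<phi>_bdd: "\<And>b. b \<in> F \<Longrightarrow> \<exists>M. \<forall>v\<in>c0. \<bar>\<phi> b v\<bar> \<le> M * norm v"
    and \<phi>_bio: "\<And>b b'. b \<in> F \<Longrightarrow> b' \<in> F \<Longrightarrow> \<phi> b b' = (if b = b' then 1 else 0)"
    and \<phi>_mem: "\<And>v. v \<in> c0 \<Longrightarrow> v \<in> X \<longleftrightarrow> (\<forall>b\<in>F. \<phi> b v = 0)"
    by (rule bounded_coordinates_mod_closed_subspace[OF assms(1,3) subspace_c0 F(1) F_c0 F(3,4)])
      (assumption+, rule that, assumption+)
  \<comment> \<open>By minimality \<open>F\<close> induces a basis of \<open>c0\<close> modulo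
    \<open>X\<close>, so \<open>m\<close> is the codimension.\<close>
  define m where "m = card F"
  obtain e where e: "bij_betw e {0..<m} F"
    using ex_bij_betw_nat_finite[OF F(1)] by (auto simp: m_def)
  have e_F: "e i \<in> F" if "i < m" for i
    using bij_betwE[OF e] that by simp
  have e_eq: "e i = e j \<longleftrightarrow> i = j" if "i < m" "j < m" for i j
    using bij_betw_imp_inj_on[OF e] that by (simp add: inj_on_eq_iff)
  have F_e: "F = e ` {..<m}"
    using bij_betw_imp_surj_on[OF e] by (simp add: lessThan_atLeast0)
  define f\<^sub>0 where "f\<^sub>0 i = (SOME n. unit_seq n = e i)" for i
  have f\<^sub>0: "unit_seq (f\<^sub>0 i) = e i" if "i < m" for i
    unfolding f\<^sub>0_def using subsetD[OF F_unit e_F[OF that]] by (metis (mono_tags) imageE someI_ex)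
  have lim: "(\<lambda>n. \<phi> (e i) (unit_seq n)) \<longlonglongrightarrow> 0" if i: "i < m" for i
  proof -
    obtain M where "\<And>v. v \<in> c0 \<Longrightarrow> \<bar>\<phi> (e i) v\<bar> \<le> M * norm v"
      using \<phi>_bdd[OF e_F[OF i]] by blast
    then show ?thesis
      by (intro unit_seq_tendsto_0[where M = M] \<phi>_add \<phi>_scale e_F i)
  qed
  \<comment> \<open>The initial matrix is the identity, as
    \<open>bounded_coefficients_selection\<close> requires.\<close>
  have kron: "\<phi> (e i) (unit_seq (f\<^sub>0 j)) = (if i = j then 1 else 0)" if "i < m" "j < m" for i j
    using that by (simp add: f\<^sub>0 \<phi>_bio e_F e_eq)
  obtain f B
    where BA: "\<And>k l. k < m \<Longrightarrow> l < m \<Longrightarrow>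
        (\<Sum>i<m. B k i * \<phi> (e i) (unit_seq (f l))) = (if k = l then 1 else 0 :: real)"
      and AB: "\<And>i l. i < m \<Longrightarrow> l < m \<Longrightarrow>
        (\<Sum>k<m. \<phi> (e i) (unit_seq (f k)) * B k l) = (if i = l then 1 else 0)"
      and B1: "\<And>k n. k < m \<Longrightarrow> \<bar>\<Sum>i<m. B k i * \<phi> (e i) (unit_seq n)\<bar> \<le> 1"
    by (rule bounded_coefficients_selection[of m "\<lambda>i n. \<phi> (e i) (unit_seq n)" f\<^sub>0, OF lim kron])
      (assumption+, rule that, assumption+)
  \<comment> \<open>The change of basis modulo \<open>X\<close> from \<open>F\<close> to the
    selected unit vectors: \<open>BA\<close> makes \<open>g\<close> dual to them and
    \<open>B1\<close> bounds its values on all unit vectors.\<close>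
  define g where "g k v = (\<Sum>i<m. B k i * \<phi> (e i) v)" for k v
  \<comment> \<open>\<open>AB\<close> recovers \<open>\<phi>\<close> from \<open>g\<close>, so both
    families have the same common kernel.\<close>
  have \<phi>_g: "\<phi> (e i) v = (\<Sum>k<m. \<phi> (e i) (unit_seq (f k)) * g k v)" if "i < m" for i v
  proof -
    have "(\<Sum>k<m. \<phi> (e i) (unit_seq (f k)) * g k v)
        = (\<Sum>k<m. \<Sum>l<m. \<phi> (e i) (unit_seq (f k)) * B k l * \<phi> (e l) v)"
      by (simp add: g_def sum_distrib_left mult.assoc)
    also have "\<dots> = (\<Sum>l<m. (\<Sum>k<m. \<phi> (e i) (unit_seq (f k)) * B k l) * \<phi> (e l) v)"
      by (subst sum.swap) (simp add: sum_distrib_right)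
    also have "\<dots> = (\<Sum>l<m. if l = i then \<phi> (e l) v else 0)"
      using that by (intro sum.cong) (simp_all add: AB)
    also have "\<dots> = \<phi> (e i) v"
      using that by simp
    finally show ?thesis by simp
  qed
  show ?thesis
  proof (rule auerbach_basis_of_coordinates[OF assms(1-3), where m = m and g = g and f = f])
    fix k v w assume "k < m" "v \<in> c0" "w \<in> c0"
    then show "g k (v + w) = g k v + g k w"
      by (simp add: g_def \<phi>_add e_F distrib_left sum.distrib)
  next
    fix k c v assume "k < m" "v \<in> c0"
    then show "g k (c *\<^sub>R v) = c * g k v"
      by (simp add: g_def \<phi>_scale e_F sum_distrib_left mult.left_commute)
  next
    fix k assume "k < m"
    have "\<forall>i. \<exists>M. i < m \<longrightarrow> (\<forall>v\<in>c0. \<bar>\<phi> (e i) v\<bar> \<le> M * norm v)"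
      using \<phi>_bdd e_F by blast
    from choice[OF this] obtain M
      where M: "\<And>i v. i < m \<Longrightarrow> v \<in> c0 \<Longrightarrow> \<bar>\<phi> (e i) v\<bar> \<le> M i * norm v"
      by blast
    have "\<bar>g k v\<bar> \<le> (\<Sum>i<m. \<bar>B k i\<bar> * M i) * norm v" if "v \<in> c0" for v
    proof -
      have "\<bar>g k v\<bar> \<le> (\<Sum>i<m. \<bar>B k i * \<phi> (e i) v\<bar>)"
        unfolding g_def by (rule sum_abs)
      also have "\<dots> \<le> (\<Sum>i<m. \<bar>B k i\<bar> * (M i * norm v))"
        using M that by (intro sum_mono) (simp add: abs_mult mult_left_mono)
      finally show ?thesis
        by (simp add: sum_distrib_right mult.assoc)
    qed
    then show "\<exists>M. \<forall>v\<in>c0. \<bar>g k v\<bar> \<le> M * norm v"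
      by blast
  next
    fix k l assume "k < m" "l < m"
    then show "g k (unit_seq (f l)) = (if k = l then 1 else 0)"
      unfolding g_def by (rule BA)
  next
    fix v :: "nat \<Rightarrow>\<^sub>C real" assume "v \<in> c0"
    then have "v \<in> X \<longleftrightarrow> (\<forall>i<m. \<phi> (e i) v = 0)"
      using \<phi>_mem[of v] by (auto simp: F_e)
    also have "\<dots> \<longleftrightarrow> (\<forall>k<m. g k v = 0)"
    proof
      assume "\<forall>i<m. \<phi> (e i) v = 0"
      then show "\<forall>k<m. g k v = 0"
        by (simp add: g_def)
    next
      assume "\<forall>k<m. g k v = 0"
      then show "\<forall>i<m. \<phi> (e i) v = 0"
        by (simp add: \<phi>_g)
    qed
    finally show "v \<in> X \<longleftrightarrow> (\<forall>k<m. g k v = 0)" .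
  next
    fix k n assume "k < m"
    then show "\<bar>g k (unit_seq n)\<bar> \<le> 1"
      unfolding g_def by (rule B1)
  qed
qed

end
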